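(* Let $d\ge 0$ be an integer and let $\mathcal{F}$ be a family of graphs that is minor-closed and $d$-degenerate. Then $\chi_o(G)\le 2d+1$ for every $G\in\mathcal{F}$.
   Context: All graphs are simple, finite, and undirected. A family $\mathcal{F}$ of graphs is minor-closed if whenever $G\in\mathcal{F}$, every minor of $G$ also belongs to $\mathcal{F}$ (minors are taken to be simple graphs: loops and parallel edges arising from edge contraction are removed). A graph is $d$-degenerate if each (non-empty) subgraph $J$ of it has a vertex $v$ with degree $d_J(v)\le d$ in $J$. The family $\mathcal{F}$ is $d$-degenerate if every graph in $\mathcal{F}$ is $d$-degenerate. A proper coloring of a graph $G$ is odd if every non-isolated vertex of $G$ has some color that appears an odd number of times on its neighborhood. The odd chromatic number $\chi_o(G)$ is the smallest number $k$ such that $G$ admits an odd $k$-coloring, i.e., an odd (proper) coloring with colors from $\{1,\dots,k\}$. *)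

theory Defs
  imports "Graph_Theory.Graph_Theory"
begin

text \<open>
  A simple finite undirected graph is a \<^locale>\<open>pair_graph\<close> of the library: a finite, loop-free
  digraph with a symmetric arc relation, so each edge is represented by its two opposite arcs.
  In particular, the degree of a vertex is its \<^const>\<open>out_degree\<close>. The vertex set may be empty.
\<close>

definition neighborhood :: "'a pair_pre_digraph \<Rightarrow> 'a \<Rightarrow> 'a set" where
  "neighborhood G v = {u. (v, u) \<in> parcs G}"

text \<open>
  Contraction of the edge between \<open>u\<close> and \<open>v\<close>; the merged vertex is called \<open>u\<close>. Arcs that would
  become loops are dropped, and parallel arcs coincide because the arcs form a set of pairs.
\<close>

definition contract_edge :: "'a pair_pre_digraph \<Rightarrow> 'a \<Rightarrow> 'a \<Rightarrow> 'a pair_pre_digraph" where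
  "contract_edge G u v =
    (let f = (\<lambda>x. if x = v then u else x)
     in \<lparr> pverts = f ` pverts G,
          parcs = {(f x, f y) | x y. (x, y) \<in> parcs G \<and> f x \<noteq> f y} \<rparr>)"

text \<open>
  Minors are taken up to isomorphism. Deleting vertices and edges amounts to passing to a subgraph.
\<close>

inductive minor_of :: "'a pair_pre_digraph \<Rightarrow> 'a pair_pre_digraph \<Rightarrow> bool" where
  refl: "minor_of G G"
| delete: "minor_of H G \<Longrightarrow> pair_graph J \<Longrightarrow> subgraph J H \<Longrightarrow> minor_of J G"
| contract: "minor_of H G \<Longrightarrow> (u, v) \<in> parcs H \<Longrightarrow> minor_of (contract_edge H u v) G"
| iso: "minor_of H G \<Longrightarrow> digraph_iso (with_proj H) (with_proj J) \<Longrightarrow> minor_of J G"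

definition minor_closed :: "'a pair_pre_digraph set \<Rightarrow> bool" where
  "minor_closed F \<longleftrightarrow> (\<forall>G\<in>F. \<forall>H. minor_of H G \<longrightarrow> H \<in> F)"

definition degenerate :: "nat \<Rightarrow> 'a pair_pre_digraph \<Rightarrow> bool" where
  "degenerate d G \<longleftrightarrow>
    (\<forall>J :: 'a pair_pre_digraph. pair_graph J \<and> subgraph J G \<and> pverts J \<noteq> {} \<longrightarrow>
      (\<exists>v\<in>pverts J. out_degree J v \<le> d))"

definition degenerate_family :: "nat \<Rightarrow> 'a pair_pre_digraph set \<Rightarrow> bool" where
  "degenerate_family d F \<longleftrightarrow> (\<forall>G\<in>F. degenerate d G)"

definition proper_coloring :: "'a pair_pre_digraph \<Rightarrow> ('a \<Rightarrow> nat) \<Rightarrow> bool" where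
  "proper_coloring G c \<longleftrightarrow> (\<forall>(u, v)\<in>parcs G. c u \<noteq> c v)"

definition odd_coloring :: "'a pair_pre_digraph \<Rightarrow> ('a \<Rightarrow> nat) \<Rightarrow> bool" where
  "odd_coloring G c \<longleftrightarrow> proper_coloring G c \<and>
    (\<forall>v\<in>pverts G. neighborhood G v \<noteq> {} \<longrightarrow>
      (\<exists>k. odd (card {u \<in> neighborhood G v. c u = k})))"

definition odd_colorable :: "'a pair_pre_digraph \<Rightarrow> nat \<Rightarrow> bool" where
  "odd_colorable G k \<longleftrightarrow> (\<exists>c. c ` pverts G \<subseteq> {1..k} \<and> odd_coloring G c)"

definition odd_chromatic_number :: "'a pair_pre_digraph \<Rightarrow> nat" where
  "odd_chromatic_number G = (LEAST k. odd_colorable G k)"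

text \<open>The least number above exists: colour all vertices differently.\<close>

lemma odd_colorable_exists:
  assumes "pair_graph G"
  shows "\<exists>k. odd_colorable G k"
proof -
  interpret pair_graph G by fact
  obtain h where h: "bij_betw h (pverts G) {1..card (pverts G)}"
    using pair_finite_verts ex_bij_betw_finite_nat[of "pverts G"]
    by (metis atLeastAtMost_iff card_atLeastAtMost diff_Suc_1 finite_atLeastAtMost
        finite_same_card_bij)
  then have inj: "inj_on h (pverts G)" by (rule bij_betw_imp_inj_on)
  have proper: "proper_coloring G h"
    unfolding proper_coloring_def
  proof clarify
    fix u v assume uv: "(u, v) \<in> parcs G" and eq: "h u = h v"
    have "u = v"
      using inj_onD[OF inj eq] in_arcsD1[OF uv] in_arcsD2[OF uv] by blast
    with no_loops'[OF uv] show False by simp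
  qed
  have "\<exists>k. odd (card {u \<in> neighborhood G v. h u = k})"
    if ne: "neighborhood G v \<noteq> {}" for v
  proof -
    obtain w where w: "w \<in> neighborhood G v" using ne by blast
    then have "{u \<in> neighborhood G v. h u = h w} = {w}"
      using inj by (auto simp: neighborhood_def dest: in_arcsD2 inj_onD)
    then have "odd (card {u \<in> neighborhood G v. h u = h w})" by simp
    then show ?thesis by blast
  qed
  with proper have "odd_coloring G h" by (auto simp: odd_coloring_def)
  moreover have "h ` pverts G \<subseteq> {1..card (pverts G)}" using h by (simp add: bij_betw_def)
  ultimately show ?thesis unfolding odd_colorable_def by blast
qed

lemma pair_graph_contract_edge:
  assumes "pair_graph G" and "(u, v) \<in> parcs G"
  shows "pair_graph (contract_edge G u v)"
proof -
  interpret pair_graph G by fact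
  define f where "f = (\<lambda>x. if x = v then u else x)"
  have V: "pverts (contract_edge G u v) = f ` pverts G"
    and A: "parcs (contract_edge G u v) = {(f x, f y) | x y. (x, y) \<in> parcs G \<and> f x \<noteq> f y}"
    by (simp_all add: contract_edge_def f_def Let_def)
  have fin: "finite (parcs (contract_edge G u v))"
    by (rule finite_subset[of _ "(\<lambda>(x, y). (f x, f y)) ` parcs G"])
      (use pair_finite_arcs in \<open>auto simp: A\<close>)
  have sym: "sym (parcs (contract_edge G u v))"
  proof (rule symI)
    fix a b assume "(a, b) \<in> parcs (contract_edge G u v)"
    then obtain x y where xy: "(x, y) \<in> parcs G" "f x \<noteq> f y" "a = f x" "b = f y"
      by (auto simp: A)
    from xy(1) have "(y, x) \<in> parcs G" by (rule arcs_symmetric)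
    with xy show "(b, a) \<in> parcs (contract_edge G u v)" unfolding A by force
  qed
  show ?thesis
    by unfold_locales
      (use fin sym pair_finite_verts in
        \<open>auto simp: V A symmetric_def dest: in_arcsD1 in_arcsD2\<close>)
qed

lemma pair_graph_minor_of:
  assumes "minor_of H G" and "pair_graph G"
  shows "pair_graph H"
  using assms
proof (induction rule: minor_of.induct)
  case (iso H G J)
  then interpret H: pair_graph H by simp
  obtain f where f: "H.digraph_isomorphism f" "with_proj J = app_iso f (with_proj H)"
    using iso.hyps(2) by (auto simp: digraph_iso_def)
  have V: "pverts J = iso_verts f ` pverts H" and A0: "parcs J = iso_arcs f ` parcs H"
    and tl: "iso_tail f = fst" and hd: "iso_head f = snd"
    using arg_cong[OF f(2), of verts] arg_cong[OF f(2), of arcs]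
      arg_cong[OF f(2), of tail] arg_cong[OF f(2), of head] by simp_all
  have arc: "iso_arcs f (x, y) = (iso_verts f x, iso_verts f y)" if "(x, y) \<in> parcs H" for x y
    using H.iso_verts_tail[OF f(1), of "(x, y)"] H.iso_verts_head[OF f(1), of "(x, y)"] that
    by (simp add: tl hd prod_eq_iff)
  then have A: "parcs J = {(iso_verts f x, iso_verts f y) | x y. (x, y) \<in> parcs H}"
    unfolding A0 by force
  have inj: "inj_on (iso_verts f) (pverts H)"
    using H.digraph_isomorphism_inj_on_verts[OF f(1)] by simp
  have "sym (parcs J)"
    by (rule symI) (use H.arcs_symmetric in \<open>auto simp: A\<close>)
  moreover have "finite (parcs J)" using H.pair_finite_arcs by (simp add: A0)
  moreover have "iso_verts f x \<noteq> iso_verts f y" if "(x, y) \<in> parcs H" for x y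
    using inj_onD[OF inj] H.in_arcsD1[OF that] H.in_arcsD2[OF that] H.no_loops'[OF that] by blast
  ultimately show ?case
    by unfold_locales
      (use H.pair_finite_verts in
        \<open>auto simp: V A symmetric_def dest: H.in_arcsD1 H.in_arcsD2\<close>)
qed (simp_all add: pair_graph_contract_edge)

end

theory Submission
  imports Defs
begin

text \<open>
  Induct on the number of vertices. A vertex \<open>v\<close> of degree at most \<open>d\<close> is contracted into a
  neighbour \<open>w\<close> (or deleted if it is isolated), and the smaller graph is coloured. In the
  contraction \<open>w\<close> is adjacent to all other neighbours of \<open>v\<close>, so its colour occurs exactly once
  around \<open>v\<close>. Each neighbour of \<open>v\<close> forbids at most two colours at \<open>v\<close>: its own, and one
  colour that occurs an odd number of times on the rest of its neighbourhood. If there is no such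
  colour, any colour of \<open>v\<close> occurs an odd number of times.
\<close>

text \<open>Serves both reductions, contraction and deletion. No hypothesis depends on
  \<open>c v\<close>: by symmetry, \<open>v\<close> lies in no neighbourhood of a vertex outside
  \<open>neighborhood G v\<close>. So \<open>c\<close> may come from a graph without
  \<open>v\<close>. Neighbours of \<open>v\<close> carry no parity hypothesis because the new colour
  of \<open>v\<close> takes care of them.\<close>

lemma odd_colorable_extend_vertex:
  assumes G: "pair_graph G" and v: "v \<in> pverts G"
    and deg: "2 * card (neighborhood G v) < k"
    and range: "c ` (pverts G - {v}) \<subseteq> {1..k}"
    and proper: "\<And>x y. (x, y) \<in> parcs G \<Longrightarrow> x \<noteq> v \<Longrightarrow> y \<noteq> v \<Longrightarrow> c x \<noteq> c y"
    and odd: "\<And>x. x \<in> pverts G \<Longrightarrow> x \<notin> neighborhood G v \<Longrightarrow> neighborhood G x \<noteq> {} \<Longrightarrow>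
      \<exists>j. odd (card {u \<in> neighborhood G x. c u = j})"
  shows "odd_colorable G k"
proof -
  interpret pair_graph G by fact
  let ?N = "neighborhood G"
  have fin: "finite (?N x)" for x
    by (rule finite_subset[OF _ pair_finite_verts])
      (auto simp: neighborhood_def dest: in_arcsD2)
  have nbh_sym: "x \<in> ?N y \<longleftrightarrow> y \<in> ?N x" for x y
    using arcs_symmetric by (auto simp: neighborhood_def)
  \<comment> \<open>If no colour is odd on the rest of the neighbourhood, \<open>p x\<close> is
    arbitrary. This may forbid one colour too many, but the count of two per neighbour already
    includes it.\<close>
  define p where "p x = (SOME j. odd (card {u \<in> ?N x - {v}. c u = j}))" for x
  have "card (c ` ?N v \<union> p ` ?N v) \<le> card (?N v) + card (?N v)"
    using card_Un_le[of "c ` ?N v" "p ` ?N v"] card_image_le[OF fin, of c v]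
      card_image_le[OF fin, of p v] by linarith
  with deg have "card (c ` ?N v \<union> p ` ?N v) < card {1..k}" by simp
  moreover have "finite (c ` ?N v \<union> p ` ?N v)" using fin by simp
  ultimately have "\<not> {1..k} \<subseteq> c ` ?N v \<union> p ` ?N v"
    using card_mono by (metis not_less)
  then obtain a where a: "a \<in> {1..k}" "a \<notin> c ` ?N v" "a \<notin> p ` ?N v" by blast
  define c' where "c' = c(v := a)"
  have "proper_coloring G c'"
    unfolding proper_coloring_def
  proof clarify
    fix x y assume xy: "(x, y) \<in> parcs G" and eq: "c' x = c' y"
    have "x \<noteq> y" using xy no_loops' by blast
    moreover have "c x \<noteq> a" if "y = v"
      using a(2) xy that nbh_sym by (auto simp: neighborhood_def)
    moreover have "c y \<noteq> a" if "x = v"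
      using a(2) xy that by (auto simp: neighborhood_def)
    ultimately show False
      using eq proper[OF xy] by (auto simp: c'_def split: if_splits)
  qed
  moreover have "\<exists>j. odd (card {u \<in> ?N x. c' u = j})"
    if x: "x \<in> pverts G" and ne: "?N x \<noteq> {}" for x
  proof (cases "x \<in> ?N v")
    case False
    then have "v \<notin> ?N x" using nbh_sym by blast
    then have "{u \<in> ?N x. c' u = j} = {u \<in> ?N x. c u = j}" for j
      by (auto simp: c'_def)
    then show ?thesis using odd[OF x False ne] by simp
  next
    case True
    show ?thesis
    proof (cases "\<exists>j. odd (card {u \<in> ?N x - {v}. c u = j})")
      case True
      then have "odd (card {u \<in> ?N x - {v}. c u = p x})"
        unfolding p_def by (rule someI_ex)
      \<comment> \<open>As \<open>v\<close> gets a colour other than \<open>p x\<close>, it does not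
        join the class of \<open>p x\<close> around \<open>x\<close>, and that class stays
        odd.\<close>
      moreover have "a \<noteq> p x" using a(3) \<open>x \<in> ?N v\<close> by blast
      then have "{u \<in> ?N x. c' u = p x} = {u \<in> ?N x - {v}. c u = p x}"
        by (auto simp: c'_def)
      ultimately show ?thesis by metis
    next
      case False
      have "{u \<in> ?N x. c' u = a} = insert v {u \<in> ?N x - {v}. c u = a}"
        using \<open>x \<in> ?N v\<close> nbh_sym by (auto simp: c'_def)
      then have "card {u \<in> ?N x. c' u = a} = Suc (card {u \<in> ?N x - {v}. c u = a})"
        using fin by simp
      then have "odd (card {u \<in> ?N x. c' u = a})" using False by simp
      then show ?thesis by blast
    qed
  qed
  ultimately have "odd_coloring G c'" by (simp add: odd_coloring_def)
  moreover have "c' ` pverts G \<subseteq> {1..k}"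
    using range a(1) by (force simp: c'_def)
  ultimately show ?thesis unfolding odd_colorable_def by blast
qed

lemma pverts_contract_edge:
  "u \<in> pverts G \<Longrightarrow> u \<noteq> v \<Longrightarrow> pverts (contract_edge G u v) = pverts G - {v}"
  by (auto simp: contract_edge_def Let_def)

text \<open>Separates the arcs that the merging fixes from those redirected from \<open>v\<close> to
  \<open>u\<close>. The former keep a colouring proper away from \<open>v\<close>; the latter set
  the colour of \<open>u\<close> apart from the other neighbours of \<open>v\<close>.\<close>

lemma parcs_contract_edge:
  assumes "pair_graph G" and "u \<noteq> v"
  shows "parcs (contract_edge G u v) =
    {(x, y). (x, y) \<in> parcs G \<and> x \<noteq> v \<and> y \<noteq> v} \<union>
    {(u, y) | y. y \<in> neighborhood G v \<and> y \<noteq> u} \<union>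
    {(x, u) | x. x \<in> neighborhood G v \<and> x \<noteq> u}"
proof -
  interpret pair_graph G by fact
  have sym: "(x, y) \<in> parcs G \<longleftrightarrow> (y, x) \<in> parcs G" for x y
    using arcs_symmetric by blast
  have irrefl: "(x, x) \<notin> parcs G" for x using no_loops' by blast
  show ?thesis (is "?L = ?R")
  proof (rule set_eqI, rule iffI)
    fix e assume "e \<in> ?L"
    then show "e \<in> ?R"
      using sym by (auto simp: contract_edge_def Let_def neighborhood_def split: if_splits)
  next
    fix e assume "e \<in> ?R"
    then show "e \<in> ?L"
      unfolding contract_edge_def Let_def neighborhood_def
      using assms(2) sym irrefl by (auto; metis)
  qed
qed

text \<open>Apart from the removal of \<open>v\<close>, contraction changes neighbourhoods only at
  neighbours of \<open>v\<close>, where \<open>odd_colorable_extend_vertex\<close> asks for no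
  parity. Every other vertex inherits its odd colour.\<close>

lemma odd_colorable_if_contract_edge:
  assumes G: "pair_graph G" and wv: "(w, v) \<in> parcs G"
    and deg: "2 * card (neighborhood G v) < k"
    and col: "odd_colorable (contract_edge G w v) k"
  shows "odd_colorable G k"
proof -
  interpret pair_graph G by fact
  let ?N = "neighborhood G" and ?H = "contract_edge G w v"
  have wv_verts: "w \<in> pverts G" "v \<in> pverts G" "w \<noteq> v"
    using wv in_arcsD1 in_arcsD2 no_loops' by blast+
  have w: "w \<in> ?N v" using arcs_symmetric[OF wv] by (simp add: neighborhood_def)
  note V = pverts_contract_edge[OF wv_verts(1,3)]
  note A = parcs_contract_edge[OF G wv_verts(3)]
  from col obtain c where range: "c ` pverts ?H \<subseteq> {1..k}" and c: "odd_coloring ?H c"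
    unfolding odd_colorable_def by blast
  have proper: "c x \<noteq> c y" if "(x, y) \<in> parcs ?H" for x y
    using c that by (auto simp: odd_coloring_def proper_coloring_def)
  show ?thesis
  proof (rule odd_colorable_extend_vertex[OF G wv_verts(2) deg])
    show "c ` (pverts G - {v}) \<subseteq> {1..k}" using range V by simp
    show "c x \<noteq> c y" if "(x, y) \<in> parcs G" "x \<noteq> v" "y \<noteq> v" for x y
      using that A by (intro proper) blast
  next
    fix x assume x: "x \<in> pverts G" "x \<notin> ?N v" "?N x \<noteq> {}"
    show "\<exists>j. odd (card {u \<in> ?N x. c u = j})"
    proof (cases "x = v")
      case True
      \<comment> \<open>The vertex \<open>v\<close> is absent from \<open>?H\<close> and inherits
        nothing; the redirected arcs between \<open>u\<close> and \<open>w\<close> are used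
        instead.\<close>
      have "c u \<noteq> c w" if "u \<in> ?N v" "u \<noteq> w" for u
        using that A by (intro proper) blast
      then have "{u \<in> ?N x. c u = c w} = {w}" using w True by auto
      then have "odd (card {u \<in> ?N x. c u = c w})" by simp
      then show ?thesis by blast
    next
      case False
      have "x \<noteq> w" using w x(2) by blast
      moreover have "(x, v) \<notin> parcs G"
        using x(2) arcs_symmetric by (auto simp: neighborhood_def)
      ultimately have "neighborhood ?H x = ?N x"
        using x(2) False unfolding neighborhood_def A by auto
      moreover have "x \<in> pverts ?H" using x(1) False V by simp
      ultimately show ?thesis
        using c x(3) unfolding odd_coloring_def by metis
    qed
  qed
qed

text \<open>An isolated vertex lies in no neighbourhood and forbids nothing, so one available colour
  suffices; \<open>k > 0\<close> is the degree bound in this case.\<close>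

lemma odd_colorable_if_delete_isolated:
  assumes G: "pair_graph G" and v: "v \<in> pverts G" and iso: "neighborhood G v = {}"
    and k: "k > 0"
    and col: "odd_colorable \<lparr> pverts = pverts G - {v}, parcs = parcs G \<rparr> k" (is "odd_colorable ?H k")
  shows "odd_colorable G k"
proof -
  from col obtain c where c: "c ` (pverts G - {v}) \<subseteq> {1..k}" "odd_coloring ?H c"
    unfolding odd_colorable_def by auto
  show ?thesis
    by (rule odd_colorable_extend_vertex[OF G v _ c(1)])
      (use c(2) iso k in \<open>auto simp: odd_coloring_def proper_coloring_def neighborhood_def\<close>)
qed

lemma (in pair_graph) out_degree_eq_card_neighborhood:
  "out_degree G v = card (neighborhood G v)"
proof -
  have "out_arcs G v = Pair v ` neighborhood G v"
    by (auto simp: out_arcs_def neighborhood_def)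
  then show ?thesis
    by (simp add: out_degree_def card_image inj_on_def)
qed

lemma odd_colorable_minor_closed_degenerate:
  assumes F: "\<forall>H\<in>F. pair_graph H" "minor_closed F" "degenerate_family d F"
    and "G \<in> F"
  shows "odd_colorable G (2 * d + 1)"
  using \<open>G \<in> F\<close>
proof (induction "card (pverts G)" arbitrary: G rule: less_induct)
  case less
  have G: "pair_graph G" using F(1) less.prems by blast
  interpret pair_graph G by (rule G)
  \<comment> \<open>Minor-closure keeps \<open>H\<close> in \<open>F\<close>, and losing
    \<open>v\<close> lowers the induction measure.\<close>
  have smaller: "odd_colorable H (2 * d + 1)"
    if "minor_of H G" "pverts H = pverts G - {v}" "v \<in> pverts G" for H v
    using that less F(2) pair_finite_verts
    by (metis card_Diff1_less minor_closed_def)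
  show ?case
  proof (cases "pverts G = {}")
    case True
    then show ?thesis
      using in_arcsD1
      by (auto simp: odd_colorable_def odd_coloring_def proper_coloring_def)
  next
    case False
    \<comment> \<open>Degeneracy is applied to \<open>G\<close> as a subgraph of itself.\<close>
    have "subgraph G G" by (rule subgraph_refl)
    then obtain v where v: "v \<in> pverts G" "card (neighborhood G v) \<le> d"
      using F(3) less.prems G False
      unfolding degenerate_family_def degenerate_def
      by (metis out_degree_eq_card_neighborhood)
    show ?thesis
    proof (cases "neighborhood G v = {}")
      case True
      let ?H = "\<lparr> pverts = pverts G - {v}, parcs = parcs G \<rparr>"
      \<comment> \<open>No arc meets \<open>v\<close>, so \<open>?H\<close> can keep all arcs and
        still be well-formed.\<close>
      have no_arc: "x \<noteq> v" "y \<noteq> v" if "(x, y) \<in> parcs G" for x y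
        using that arcs_symmetric[OF that] True by (auto simp: neighborhood_def)
      have H: "pair_graph ?H"
        by unfold_locales
          (use pair_finite_verts pair_finite_arcs no_loops' arcs_symmetric in
            \<open>auto simp: symmetric_def sym_def dest: in_arcsD1 in_arcsD2 no_arc\<close>)
      interpret H: pair_graph ?H by (rule H)
      have "subgraph ?H G"
        by (rule subgraphI)
          (auto simp: compatible_def H.wf_digraph wf_digraph)
      then have "minor_of ?H G" by (rule minor_of.delete[OF minor_of.refl H])
      from smaller[OF this _ v(1)] show ?thesis
        by (intro odd_colorable_if_delete_isolated[OF G v(1) True]) simp_all
    next
      case False
      then obtain w where "(v, w) \<in> parcs G" by (auto simp: neighborhood_def)
      \<comment> \<open>The arc is reversed because \<open>contract_edge\<close> keeps the first
        endpoint, and \<open>v\<close> has to be the one that disappears.\<close>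
      then have wv: "(w, v) \<in> parcs G" by (rule arcs_symmetric)
      then have "minor_of (contract_edge G w v) G" by (rule minor_of.contract[OF minor_of.refl])
      moreover have "pverts (contract_edge G w v) = pverts G - {v}"
        using wv in_arcsD1 no_loops' by (intro pverts_contract_edge) blast+
      ultimately have "odd_colorable (contract_edge G w v) (2 * d + 1)"
        using v(1) by (rule smaller)
      then show ?thesis
        using v(2) by (intro odd_colorable_if_contract_edge[OF G wv]) simp_all
    qed
  qed
qed

theorem theorem2:
  fixes d :: nat and F :: "'a pair_pre_digraph set" and G :: "'a pair_pre_digraph"
  assumes "\<forall>H\<in>F. pair_graph H"
    and "minor_closed F"
    and "degenerate_family d F"
    and "G \<in> F"
  shows "odd_chromatic_number G \<le> 2 * d + 1"
  unfolding odd_chromatic_number_def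
  using odd_colorable_minor_closed_degenerate[OF assms] by (rule Least_le)

end
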